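(* Let $0<b<1$, $\omega\in\mathbb{R}$, let $l\in\mathbb{N}$ and $m\in\{-l,\dots,l\}\setminus\{0\}$, let $\lambda_{l,m}$ be the corresponding eigenvalue of $-\Delta$ on the ellipsoid $\mathbb{S}^2$, and let $Y_l^m\in\mathbb{E}_{l,m}$. Then there exists a function $g\in C^{3,\alpha}\left(\left(-\frac{\pi}{2},\frac{\pi}{2}\right)\right)$ solving the ODE \[ -\lambda_{l,m}\, g(\theta)=\frac{1}{\cos\theta\,\rho(\theta)}\left(\frac{\cos\theta}{\rho(\theta)}\,g'(\theta)\right)'+\frac{2\omega\sin\theta}{\rho(\theta)},\qquad \theta\in\left(-\tfrac{\pi}{2},\tfrac{\pi}{2}\right), \] together with the boundary conditions $\lim_{\theta\to\pm\frac{\pi}{2}} g'(\theta)=0$. Consequently, $\psi(\varphi,\theta)=g(\theta)+Y_l^m(\varphi,\theta)$ solves the stationary Euler equations \[ \left[-\partial_\theta\psi\,\partial_\varphi+\partial_\varphi\psi\,\partial_\theta\right]\left(\Delta\psi+\frac{2\omega\sin\theta}{\rho(\theta)}\right)=0 . \]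
   Context: The surface $\mathbb{S}^2$ denotes the biaxial ellipsoid with major axis $1$ and minor axis $b\in(0,1)$, parametrized by $(\varphi,\theta)\in[-\pi,\pi)\times[-\frac{\pi}{2},\frac{\pi}{2}]\mapsto(\cos\varphi\cos\theta,\sin\varphi\cos\theta,b\sin\theta)$; functions are $2\pi$-periodic in $\varphi$. Write $\rho(\theta)=\sqrt{\sin^2\theta+b^2\cos^2\theta}$. The Riemannian area element is $d\sigma=\cos\theta\,\rho(\theta)\,d\varphi\,d\theta$, and the Laplace–Beltrami operator is $\Delta\psi=\frac{1}{\cos^2\theta}\partial_{\varphi\varphi}\psi+\frac{1}{\cos\theta\,\rho(\theta)}\partial_\theta\!\left(\frac{\cos\theta}{\rho(\theta)}\partial_\theta\psi\right)$. For $l\in\mathbb{N}$ and $m\in\{-l,\dots,l\}$, $\mathbb{E}_{l,m}$ denotes the $(l,m)$-th eigenspace of $-\Delta$ on $\mathbb{S}^2$ with eigenvalue $\lambda_{l,m}$ (labelled so that as $b\to1$, $\lambda_{l,m}\to l(l+1)$); for $m\neq0$ it is assumed that $\mathbb{E}_{l,m}$ has an $L^2(\mathbb{S}^2,d\sigma)$-orthonormal basis of the form $\{y_1(\theta)e^{im\varphi},\,y_2(\theta)e^{-im\varphi}\}$ with smooth $y_1,y_2$. $C^{3,\alpha}$ denotes the Hölder space with some exponent $\alpha\in(0,1)$. *)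

theory Defs
  imports "HOL-Analysis.Analysis"
begin

definition rho :: "real \<Rightarrow> real \<Rightarrow> real" where
  "rho b \<theta> = sqrt ((sin \<theta>)\<^sup>2 + b\<^sup>2 * (cos \<theta>)\<^sup>2)"

definition ell_pt :: "real \<Rightarrow> real \<Rightarrow> real \<Rightarrow> real \<times> real \<times> real" where
  "ell_pt b \<phi> \<theta> = (cos \<phi> * cos \<theta>, sin \<phi> * cos \<theta>, b * sin \<theta>)"

primrec Cn :: "nat \<Rightarrow> ('a::euclidean_space \<Rightarrow> 'b::real_normed_vector) \<Rightarrow> bool" where
  "Cn 0 f = continuous_on UNIV f"
| "Cn (Suc n) f = (\<exists>f'. (\<forall>x. (f has_derivative f' x) (at x)) \<and> (\<forall>v. Cn n (\<lambda>x. f' x v)))"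

definition smooth_map :: "('a::euclidean_space \<Rightarrow> 'b::real_normed_vector) \<Rightarrow> bool" where
  "smooth_map f \<longleftrightarrow> (\<forall>n. Cn n f)"

text \<open>A function on the ellipsoid, written in coordinates (phi, theta), is smooth iff it is
  the restriction of a smooth function on R^3 (the ellipsoid is a closed embedded submanifold).\<close>

definition smooth_S2 :: "real \<Rightarrow> (real \<Rightarrow> real \<Rightarrow> complex) \<Rightarrow> bool" where
  "smooth_S2 b \<psi> \<longleftrightarrow> (\<exists>F :: real \<times> real \<times> real \<Rightarrow> complex. smooth_map F \<and>
      (\<forall>\<phi> \<theta>. \<theta> \<in> {-pi/2..pi/2} \<longrightarrow> \<psi> \<phi> \<theta> = F (ell_pt b \<phi> \<theta>)))"

definition d_phi :: "(real \<Rightarrow> real \<Rightarrow> 'a::real_normed_vector) \<Rightarrow> real \<Rightarrow> real \<Rightarrow> 'a" where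
  "d_phi f \<phi> \<theta> = vector_derivative (\<lambda>p. f p \<theta>) (at \<phi>)"

definition d_theta :: "(real \<Rightarrow> real \<Rightarrow> 'a::real_normed_vector) \<Rightarrow> real \<Rightarrow> real \<Rightarrow> 'a" where
  "d_theta f \<phi> \<theta> = vector_derivative (\<lambda>t. f \<phi> t) (at \<theta>)"

definition lap :: "real \<Rightarrow> (real \<Rightarrow> real \<Rightarrow> complex) \<Rightarrow> real \<Rightarrow> real \<Rightarrow> complex" where
  "lap b f \<phi> \<theta> =
     complex_of_real (1 / (cos \<theta>)\<^sup>2) * d_phi (d_phi f) \<phi> \<theta>
   + complex_of_real (1 / (cos \<theta> * rho b \<theta>)) *
       d_theta (\<lambda>p t. complex_of_real (cos t / rho b t) * d_theta f p t) \<phi> \<theta>"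

definition eigsp :: "real \<Rightarrow> real \<Rightarrow> (real \<Rightarrow> real \<Rightarrow> complex) set" where
  "eigsp b \<mu> = {\<psi>. smooth_S2 b \<psi> \<and>
      (\<forall>\<phi> \<theta>. \<theta> \<in> {-pi/2<..<pi/2} \<longrightarrow> - lap b \<psi> \<phi> \<theta> = complex_of_real \<mu> * \<psi> \<phi> \<theta>)}"

definition mode_eigs :: "real \<Rightarrow> int \<Rightarrow> real set" where
  "mode_eigs b k = {\<mu>. \<exists>y :: real \<Rightarrow> complex. (\<exists>\<theta>\<in>{-pi/2..pi/2}. y \<theta> \<noteq> 0) \<and>
       (\<lambda>\<phi> \<theta>. y \<theta> * cis (of_int k * \<phi>)) \<in> eigsp b \<mu>}"

text \<open>lambda_{l,m}: the (l-|m|)-th (counting from 0) eigenvalue of mode |m|, in increasing order.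
  At b = 1 these are l(l+1); this is the labelling obtained by continuity as b -> 1.\<close>

definition lam :: "real \<Rightarrow> nat \<Rightarrow> int \<Rightarrow> real" where
  "lam b l m = (THE \<mu>. \<mu> \<in> mode_eigs b \<bar>m\<bar> \<and>
       card {\<nu> \<in> mode_eigs b \<bar>m\<bar>. \<nu> < \<mu>} = l - nat \<bar>m\<bar>)"

abbreviation E :: "real \<Rightarrow> nat \<Rightarrow> int \<Rightarrow> (real \<Rightarrow> real \<Rightarrow> complex) set" where
  "E b l m \<equiv> eigsp b (lam b l m)"

definition L2inner :: "real \<Rightarrow> (real \<Rightarrow> real \<Rightarrow> complex) \<Rightarrow> (real \<Rightarrow> real \<Rightarrow> complex) \<Rightarrow> complex" where
  "L2inner b f g = integral (cbox (-pi, -pi/2) (pi, pi/2))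
      (\<lambda>(\<phi>, \<theta>). f \<phi> \<theta> * cnj (g \<phi> \<theta>) * complex_of_real (cos \<theta> * rho b \<theta>))"

text \<open>(Functions are identified with their values on the coordinate domain theta in [-pi/2,pi/2].)
Standing assumption: E_{l,m} has an L^2-orthonormal basis {y1(theta) e^{i m phi}, y2(theta) e^{-i m phi}}
  with smooth y1, y2.\<close>

definition smooth_fun :: "(real \<Rightarrow> complex) \<Rightarrow> real set \<Rightarrow> bool" where
  "smooth_fun y I \<longleftrightarrow> (\<exists>D :: nat \<Rightarrow> real \<Rightarrow> complex. D 0 = y \<and>
        (\<forall>j. \<forall>x\<in>I. (D j has_vector_derivative D (Suc j) x) (at x within I)))"

definition has_ONB_modes :: "real \<Rightarrow> nat \<Rightarrow> int \<Rightarrow> bool" where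
  "has_ONB_modes b l m \<longleftrightarrow> (\<exists>y1 y2 :: real \<Rightarrow> complex.
     let e1 = (\<lambda>\<phi> \<theta>. y1 \<theta> * cis (of_int m * \<phi>));
         e2 = (\<lambda>\<phi> \<theta>. y2 \<theta> * cis (- of_int m * \<phi>)) in
     smooth_fun y1 {-pi/2..pi/2} \<and> smooth_fun y2 {-pi/2..pi/2} \<and>
     e1 \<in> E b l m \<and> e2 \<in> E b l m \<and>
     (\<forall>\<psi>\<in>E b l m. \<exists>c1 c2 :: complex. \<forall>\<phi> \<theta>. \<theta> \<in> {-pi/2..pi/2} \<longrightarrow>
         \<psi> \<phi> \<theta> = c1 * e1 \<phi> \<theta> + c2 * e2 \<phi> \<theta>) \<and>
     L2inner b e1 e1 = 1 \<and> L2inner b e2 e2 = 1 \<and> L2inner b e1 e2 = 0)"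

text \<open>Local Hoelder space C^{3,alpha}(I) (Gilbarg--Trudinger convention for open I).\<close>

definition C3_alpha :: "real \<Rightarrow> real set \<Rightarrow> (real \<Rightarrow> real) \<Rightarrow> bool" where
  "C3_alpha \<alpha> I g \<longleftrightarrow>
     (\<forall>k<3. \<forall>x\<in>I. (deriv ^^ k) g differentiable (at x)) \<and>
     (\<forall>K. compact K \<and> K \<subseteq> I \<longrightarrow>
        (\<exists>C. \<forall>x\<in>K. \<forall>y\<in>K. \<bar>(deriv ^^ 3) g x - (deriv ^^ 3) g y\<bar> \<le> C * \<bar>x - y\<bar> powr \<alpha>))"

end

theory Submission
  imports Defs "HOL-Complex_Analysis.Complex_Analysis"
begin

text \<open>
  In the variable \<open>x = sin \<theta>\<close> the equation for \<open>g\<close> becomes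
  \<open>((1 - x\<^sup>2) / r * u')' = - \<mu> r u - 2 \<omega> x\<close> with \<open>r = sqrt (b\<^sup>2 + (1 - b\<^sup>2) x\<^sup>2)\<close>, which has a regular
  singular point at \<open>x = 1\<close>. On a complex strip around \<open>(-1, \<infinity>)\<close> it has a holomorphic homogeneous
  solution \<open>v\<close> with \<open>v(1) = 1\<close> and a holomorphic particular solution \<open>w\<close>. If \<open>v(0) = 0\<close>, then \<open>v\<close> is odd
  by uniqueness at the regular point \<open>0\<close>, hence extends to the other pole and gives a smooth zonal
  eigenfunction, which the basis of modes \<open>exp (\<plusminus>i m \<phi>)\<close> excludes. Otherwise \<open>w - (w(0) / v(0)) v\<close>
  vanishes at \<open>0\<close>, is odd for the same reason and is regular at both poles; \<open>g(\<theta>)\<close> is its value at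
  \<open>sin \<theta>\<close>. Finally \<open>\<Delta>\<psi> + 2 \<omega> sin \<theta> / \<rho> = - \<mu> \<psi>\<close>, so the Jacobian of the two vanishes.
\<close>

section \<open>Linear equations with a regular singular point\<close>

text \<open>On the segment from \<open>a\<close> to \<open>z\<close> the distance to
  \<open>a\<close> grows linearly, so integrating its n-th power gains the factor 1 / (n + 1) that
  turns \<open>fact n\<close> into \<open>fact (Suc n)\<close>. In \<open>bd\<close> the point
  \<open>a\<close> is left out because the bound on \<open>f'\<close> will come from cancelling a
  factor \<open>w - a\<close>.\<close>

lemma norm_primitive_power_bound:
  fixes f f' :: "complex \<Rightarrow> complex"
  assumes "convex K" "a \<in> K" "z \<in> K" "f a = 0"
    and df: "\<And>w. w \<in> K \<Longrightarrow> (f has_field_derivative f' w) (at w)"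
    and bd: "\<And>w. w \<in> K \<Longrightarrow> w \<noteq> a \<Longrightarrow> norm (f' w) \<le> C * norm (w - a) ^ n / fact n"
  shows "norm (f z) \<le> C * norm (z - a) ^ Suc n / fact (Suc n)"
proof (cases "z = a")
  case False
  define w where "w t = a + of_real t * (z - a)" for t :: real
  have wK: "w t \<in> K" if "t \<in> {0..1}" for t
  proof -
    have "w t = (1 - t) *\<^sub>R a + t *\<^sub>R z"
      by (simp add: w_def scaleR_conv_of_real algebra_simps)
    then show ?thesis
      using that assms(1-3) by (auto simp: convex_alt)
  qed
  have dw: "((\<lambda>t. f (w t)) has_vector_derivative (z - a) * f' (w t)) (at t)"
    if "t \<in> {0..1}" for t
  proof -
    have "(w has_vector_derivative (z - a)) (at t)"
      unfolding w_def [abs_def]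
      by (rule has_vector_derivative_eq_rhs, rule derivative_intros)
         (auto intro!: derivative_eq_intros has_vector_derivative_real_field)
    from field_vector_diff_chain_at [OF this df [OF wK [OF that]]]
    show ?thesis by (simp add: o_def)
  qed
  define \<phi> where "\<phi> t = C * norm (z - a) ^ Suc n / fact (Suc n) * t ^ Suc n" for t :: real
  have "norm (f (w 1) - f (w 0)) \<le> \<phi> 1 - \<phi> 0"
  proof (rule differentiable_bound_general)
    show "continuous_on {0..1} (\<lambda>t. f (w t))"
      using dw by (meson continuous_at_imp_continuous_on has_vector_derivative_continuous)
    show "continuous_on {0..1} \<phi>"
      unfolding \<phi>_def [abs_def] by (intro continuous_intros)
    show "(\<phi> has_vector_derivative (C * norm (z - a) ^ Suc n / fact n * t ^ n)) (at t)" for t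
      unfolding has_real_derivative_iff_has_vector_derivative [symmetric] \<phi>_def [abs_def]
      by (rule derivative_eq_intros refl)+ (simp add: divide_simps)
    show "((\<lambda>t. f (w t)) has_vector_derivative (z - a) * f' (w t)) (at t)"
      if "0 < t" "t < 1" for t
      using dw that by simp
    fix t :: real assume t: "0 < t" "t < 1"
    have "w t \<noteq> a" using False t by (simp add: w_def)
    then have "norm (f' (w t)) \<le> C * norm (w t - a) ^ n / fact n"
      using bd wK t by simp
    then have "norm (z - a) * norm (f' (w t)) \<le> norm (z - a) * (C * (t * norm (z - a)) ^ n / fact n)"
      using t by (intro mult_left_mono) (auto simp: w_def norm_mult)
    then show "norm ((z - a) * f' (w t)) \<le> C * norm (z - a) ^ Suc n / fact n * t ^ n"
      by (simp add: norm_mult power_mult_distrib mult_ac)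
  qed simp
  then show ?thesis using assms(4) by (simp add: w_def \<phi>_def)
qed (simp add: assms)

text \<open>One step of the Neumann iteration: \<open>H\<close> is the integral of
  \<open>p f\<close> from \<open>a\<close>, and \<open>g\<close> that of
  \<open>q H / (z - a)\<close>. The zero of \<open>H\<close> at \<open>a\<close> cancels the pole;
  the relation for \<open>G\<close> is multiplied out so that it makes sense at \<open>a\<close>
  too.\<close>

lemma regular_singular_step:
  fixes p q f :: "complex \<Rightarrow> complex"
  assumes S: "open S" "convex S" "a \<in> S"
    and hol: "p holomorphic_on S" "q holomorphic_on S" "f holomorphic_on S"
  shows "\<exists>H g G. (\<forall>z\<in>S. (H has_field_derivative p z * f z) (at z)) \<and> H a = 0 \<and>
    (\<forall>z\<in>S. (g has_field_derivative G z) (at z)) \<and> g a = 0 \<and>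
    (\<forall>z\<in>S. (z - a) * G z = q z * H z)"
proof -
  have prim: "\<exists>F. (\<forall>z\<in>S. (F has_field_derivative h z) (at z)) \<and> F a = 0"
    if h: "h holomorphic_on S" for h :: "complex \<Rightarrow> complex"
  proof -
    obtain F where "\<And>x. x \<in> S \<Longrightarrow> (F has_field_derivative h x) (at x within S)"
      using holomorphic_convex_primitive' [OF S(2,1) h] by metis
    then have "(F has_field_derivative h z) (at z)" if "z \<in> S" for z
      using S(1) that by (metis at_within_open)
    then have "\<forall>z\<in>S. ((\<lambda>z. F z - F a) has_field_derivative h z) (at z)"
      using DERIV_diff [OF _ DERIV_const] by fastforce
    then show ?thesis by (intro exI [of _ "\<lambda>z. F z - F a"]) simp
  qed
  obtain H where H: "\<forall>z\<in>S. (H has_field_derivative p z * f z) (at z)" "H a = 0"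
    using prim [of "\<lambda>z. p z * f z"] hol by (auto intro: holomorphic_intros)
  then have "H holomorphic_on S"
    using S(1) holomorphic_on_open by blast
  then have K: "(\<lambda>z. if z = a then deriv H a else (H z - H a) / (z - a)) holomorphic_on S"
    using S by (intro pole_lemma) (auto simp: interior_open)
  define G where "G z = q z * (if z = a then deriv H a else (H z - H a) / (z - a))" for z
  have "G holomorphic_on S"
    unfolding G_def [abs_def] by (intro holomorphic_on_mult hol K)
  then obtain g where g: "\<forall>z\<in>S. (g has_field_derivative G z) (at z)" "g a = 0"
    using prim by blast
  have "(z - a) * G z = q z * H z" for z
    using H(2) by (simp add: G_def)
  with H g show ?thesis by blast
qed

text \<open>The singular equation is the Volterra equation
  \<open>v' = \<phi>' + q / (z - a) * (integral of p v from a to z)\<close>, whose kernel is holomorphic at \<open>a\<close>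
  because the integral vanishes there; its Neumann series, started at \<open>\<phi>\<close>, converges like an
  exponential series.\<close>

lemma regular_singular_solution:
  fixes p q \<phi> \<phi>' :: "complex \<Rightarrow> complex"
  assumes S: "open S" "convex S" "a \<in> S"
    and hol: "p holomorphic_on S" "q holomorphic_on S"
    and d\<phi>: "\<And>z. z \<in> S \<Longrightarrow> (\<phi> has_field_derivative \<phi>' z) (at z)"
  obtains v v' H where "\<And>z. z \<in> S \<Longrightarrow> (v has_field_derivative v' z) (at z)"
    "\<And>z. z \<in> S \<Longrightarrow> (H has_field_derivative p z * v z) (at z)"
    "\<And>z. z \<in> S \<Longrightarrow> (z - a) * (v' z - \<phi>' z) = q z * H z" "v a = \<phi> a"
proof -
  let ?hol = "\<lambda>f. f holomorphic_on S"
  \<comment> \<open>Keeping holomorphy as a premise inside the existential lets choice produce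
    operators on all functions, which can be iterated before the iterates are known to be
    holomorphic.\<close>
  have "\<forall>f. \<exists>H g G. ?hol f \<longrightarrow> (\<forall>z\<in>S. (H has_field_derivative p z * f z) (at z)) \<and> H a = 0 \<and>
      (\<forall>z\<in>S. (g has_field_derivative G z) (at z)) \<and> g a = 0 \<and>
      (\<forall>z\<in>S. (z - a) * G z = q z * H z)"
    using regular_singular_step [OF S hol] by blast
  then obtain HH gg GG where step: "\<And>f. ?hol f \<Longrightarrow>
      (\<forall>z\<in>S. (HH f has_field_derivative p z * f z) (at z)) \<and> HH f a = 0 \<and>
      (\<forall>z\<in>S. (gg f has_field_derivative GG f z) (at z)) \<and> gg f a = 0 \<and>
      (\<forall>z\<in>S. (z - a) * GG f z = q z * HH f z)"
    by metis
  \<comment> \<open>\<open>u n\<close> is the n-th term of the Neumann series, \<open>u' n\<close>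
    its derivative, and \<open>h n\<close> the integral of \<open>p * u n\<close> from
    \<open>a\<close>.\<close>
  define u where "u n = (gg ^^ n) \<phi>" for n
  define u' where "u' n = (case n of 0 \<Rightarrow> \<phi>' | Suc k \<Rightarrow> GG (u k))" for n
  define h where "h n = HH (u n)" for n
  have u0: "u 0 = \<phi>" "u' 0 = \<phi>'" and uS: "u (Suc n) = gg (u n)" "u' (Suc n) = GG (u n)" for n
    by (simp_all add: u_def u'_def)
  have hu: "?hol (u n)" for n
  proof (induction n)
    case 0
    show ?case using d\<phi> S(1) u0(1) holomorphic_on_open by metis
  next
    case (Suc n)
    with step [OF Suc] S(1) show ?case unfolding uS(1) using holomorphic_on_open by blast
  qed
  note st = step [OF hu]
  have du: "(u n has_field_derivative u' n z) (at z)" if "z \<in> S" for n z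
    using that d\<phi> st by (cases n) (auto simp: u0 uS)
  have dh: "(h n has_field_derivative p z * u n z) (at z)" if "z \<in> S" for n z
    using that st by (auto simp: h_def)
  have ua: "u (Suc n) a = 0" and ha: "h n a = 0" for n
    using st by (auto simp: uS h_def)
  have rel: "(z - a) * u' (Suc n) z = q z * h n z" if "z \<in> S" for n z
    using that st by (auto simp: uS h_def)
  \<comment> \<open>Near each point both series are dominated by an exponential series, as termwise
    differentiation requires.\<close>
  have loc: "\<exists>d B M R. 0 < d \<and> 0 \<le> M \<and> 0 \<le> R \<and> 0 \<le> B \<and> (\<forall>n. \<forall>w\<in>ball z d \<inter> S.
      norm (u n w) \<le> M * (B * R) ^ n / fact n \<and> norm (h n w) \<le> M * (B * R) * ((B * R) ^ n / fact n))"
    if z: "z \<in> S" for z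
  proof -
    obtain d where d: "0 < d" "cball z d \<subseteq> S"
      using S(1) z open_contains_cball by blast
    \<comment> \<open>Compact, so \<open>p\<close>, \<open>q\<close> and \<open>\<phi>\<close> are
      bounded on it; convex and containing \<open>a\<close>, so integration paths from
      \<open>a\<close> stay inside.\<close>
    define K where "K = convex hull (insert a (cball z d))"
    have K: "convex K" "compact K" "a \<in> K" "K \<subseteq> S" "ball z d \<subseteq> K"
      using d(2) S hull_subset [of "insert a (cball z d)" convex]
      by (auto simp: K_def hull_minimal intro!: compact_convex_hull compact_insert)
    have bound: "\<exists>B\<ge>0. \<forall>w\<in>K. norm (f w) \<le> B" if "continuous_on S f" for f :: "complex \<Rightarrow> complex"
    proof -
      have "bounded (f ` K)"
        using K that by (intro compact_imp_bounded compact_continuous_image)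
          (auto intro: continuous_on_subset)
      then obtain B where "\<forall>w\<in>K. norm (f w) \<le> B" by (auto simp: bounded_iff)
      then show ?thesis using K(3) norm_ge_zero order_trans by blast
    qed
    obtain Bp where Bp: "Bp \<ge> 0" "\<forall>w\<in>K. norm (p w) \<le> Bp"
      using bound hol holomorphic_on_imp_continuous_on by blast
    obtain Bq where Bq: "Bq \<ge> 0" "\<forall>w\<in>K. norm (q w) \<le> Bq"
      using bound hol holomorphic_on_imp_continuous_on by blast
    obtain M where M: "M \<ge> 0" "\<forall>w\<in>K. norm (\<phi> w) \<le> M"
      using bound hu [of 0] u0 holomorphic_on_imp_continuous_on by metis
    obtain R where R: "R \<ge> 0" "\<forall>w\<in>K. norm (w - a) \<le> R"
      using bound [OF continuous_on_diff [OF continuous_on_id continuous_on_const]] by blast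
    \<comment> \<open>The added ones make a single constant dominate both \<open>Bq * Bp\<close>,
      needed for \<open>u\<close>, and \<open>Bp\<close>, needed for \<open>h\<close>.\<close>
    define B where "B = (Bp + 1) * (Bq + 1)"
    have B: "0 \<le> B" "Bq * Bp \<le> B" "Bp \<le> B"
      using Bp Bq by (auto simp: B_def algebra_simps)
    have hb: "norm (h n w) \<le> Bp * (M * B ^ n) * norm (w - a) ^ Suc n / fact (Suc n)"
      if ub: "\<And>w. w \<in> K \<Longrightarrow> norm (u n w) \<le> M * B ^ n * norm (w - a) ^ n / fact n"
        and w: "w \<in> K" for n w
    proof (rule norm_primitive_power_bound [OF K(1,3) w ha dh])
      show "norm (p w * u n w) \<le> Bp * (M * B ^ n) * norm (w - a) ^ n / fact n" if "w \<in> K" for w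
        using mult_mono [OF bspec [OF Bp(2) that] ub [OF that] Bp(1) norm_ge_zero]
        by (simp add: norm_mult mult_ac)
    qed (use K in auto)
    have ub: "\<forall>w\<in>K. norm (u n w) \<le> M * B ^ n * norm (w - a) ^ n / fact n" for n
    proof (induction n)
      case 0
      then show ?case using M by (simp add: u0)
    next
      case (Suc n)
      show ?case
      proof
        fix w assume w: "w \<in> K"
        show "norm (u (Suc n) w) \<le> M * B ^ Suc n * norm (w - a) ^ Suc n / fact (Suc n)"
        proof (rule norm_primitive_power_bound [OF K(1,3) w ua du])
          fix w assume w: "w \<in> K" "w \<noteq> a"
          \<comment> \<open>The bound for \<open>h n\<close> carries the power \<open>Suc n\<close>
            of \<open>norm (w - a)\<close>; the extra one pays for the division by
            \<open>w - a\<close>.\<close>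
          have "norm (w - a) * norm (u' (Suc n) w) = norm (q w) * norm (h n w)"
            using rel [of w n] w K(4) by (metis norm_mult subsetD)
          also have "\<dots> \<le> Bq * (Bp * (M * B ^ n) * norm (w - a) ^ Suc n / fact (Suc n))"
            using hb [of n w] Suc Bq w by (intro mult_mono) auto
          also have "\<dots> = norm (w - a) * ((Bq * Bp) * (M * B ^ n * norm (w - a) ^ n / fact (Suc n)))"
            by simp
          finally have "norm (u' (Suc n) w) \<le> (Bq * Bp) * (M * B ^ n * norm (w - a) ^ n / fact (Suc n))"
            using w(2) by (subst (asm) mult_le_cancel_left_pos) auto
          also have "\<dots> \<le> B * (M * B ^ n * norm (w - a) ^ n / fact n)"
          proof (intro mult_mono divide_left_mono B)
            show "(fact n :: real) \<le> fact (Suc n)" by (rule fact_mono) simp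
          qed (use B M in auto)
          finally show "norm (u' (Suc n) w) \<le> M * B ^ Suc n * norm (w - a) ^ n / fact n"
            by (simp add: mult_ac)
        qed (use K in auto)
      qed
    qed
    have pw: "norm (w - a) ^ k \<le> R ^ k" if "w \<in> K" for w k
      using R that by (intro power_mono) auto
    have "norm (u n w) \<le> M * (B * R) ^ n / fact n" if "w \<in> K" for n w
    proof -
      have "norm (u n w) \<le> M * B ^ n * norm (w - a) ^ n / fact n" using ub that by blast
      also have "\<dots> \<le> M * B ^ n * R ^ n / fact n"
        using pw [OF that] M B by (intro divide_right_mono mult_left_mono) auto
      finally show ?thesis by (simp add: power_mult_distrib mult_ac)
    qed
    moreover have "norm (h n w) \<le> M * (B * R) * ((B * R) ^ n / fact n)" if w: "w \<in> K" for n w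
    proof -
      have "norm (h n w) \<le> Bp * (M * B ^ n) * norm (w - a) ^ Suc n / fact (Suc n)"
        using hb ub w by blast
      also have "\<dots> \<le> B * (M * B ^ n) * R ^ Suc n / fact n"
      proof (intro frac_le mult_mono pw w B)
        show "(fact n :: real) \<le> fact (Suc n)" by (rule fact_mono) simp
      qed (use B M R in auto)
      finally show ?thesis by (simp add: power_mult_distrib mult_ac)
    qed
    ultimately show ?thesis
      using d(1) M(1) R(1) B(1) K(5) by (intro exI [of _ d] exI [of _ B] exI [of _ M] exI [of _ R]) auto
  qed
  have maj: "\<exists>d k. 0 < d \<and> summable k \<and> range k \<subseteq> \<real>\<^sub>\<ge>\<^sub>0 \<and>
      (\<forall>\<^sub>F n in sequentially. \<forall>y\<in>ball z d \<inter> S. norm (f n y) \<le> norm (k n :: complex))"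
    if "0 < d" "0 \<le> C" "0 \<le> x" and "\<forall>n. \<forall>w\<in>ball z d \<inter> S. norm (f n w) \<le> C * (x ^ n / fact n)"
    for f :: "nat \<Rightarrow> complex \<Rightarrow> complex" and z d C and x :: real
  proof (intro exI conjI)
    have "summable (\<lambda>n. C * (x ^ n / fact n))"
      using summable_exp [of x] by (intro summable_mult) (simp add: divide_inverse mult.commute)
    then show "summable (\<lambda>n. complex_of_real (C * (x ^ n / fact n)))"
      by (rule summable_of_real)
    show "range (\<lambda>n. complex_of_real (C * (x ^ n / fact n))) \<subseteq> \<real>\<^sub>\<ge>\<^sub>0"
      using that by (auto simp del: of_real_mult of_real_divide)
    show "\<forall>\<^sub>F n in sequentially. \<forall>y\<in>ball z d \<inter> S.
        norm (f n y) \<le> norm (complex_of_real (C * (x ^ n / fact n)))"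
      using that by (intro always_eventually allI) (simp only: norm_of_real, simp)
  qed (rule that)
  have "\<exists>d k. 0 < d \<and> summable k \<and> range k \<subseteq> \<real>\<^sub>\<ge>\<^sub>0 \<and>
      (\<forall>\<^sub>F n in sequentially. \<forall>y\<in>ball z d \<inter> S. norm (u n y) \<le> norm (k n :: complex))"
    if "z \<in> S" for z
  proof -
    from loc [OF that] obtain d B M R where "0 < d" "0 \<le> M" "0 \<le> R" "0 \<le> B"
      "\<forall>n. \<forall>w\<in>ball z d \<inter> S. norm (u n w) \<le> M * (B * R) ^ n / fact n"
      by blast
    then show ?thesis by (intro maj [of d M "B * R"]) auto
  qed
  from series_and_derivative_comparison_complex [OF S(1) du this]
  obtain v v' where v: "\<And>z. z \<in> S \<Longrightarrow> (\<lambda>n. u n z) sums v z"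
    "\<And>z. z \<in> S \<Longrightarrow> (\<lambda>n. u' n z) sums v' z" "\<And>z. z \<in> S \<Longrightarrow> (v has_field_derivative v' z) (at z)"
    by blast
  have "\<exists>d k. 0 < d \<and> summable k \<and> range k \<subseteq> \<real>\<^sub>\<ge>\<^sub>0 \<and>
      (\<forall>\<^sub>F n in sequentially. \<forall>y\<in>ball z d \<inter> S. norm (h n y) \<le> norm (k n :: complex))"
    if "z \<in> S" for z
  proof -
    from loc [OF that] obtain d B M R where "0 < d" "0 \<le> M" "0 \<le> R" "0 \<le> B"
      "\<forall>n. \<forall>w\<in>ball z d \<inter> S. norm (h n w) \<le> M * (B * R) * ((B * R) ^ n / fact n)"
      by blast
    then show ?thesis by (intro maj [of d "M * (B * R)" "B * R"]) auto
  qed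
  from series_and_derivative_comparison_complex [OF S(1) dh this]
  obtain H H' where H: "\<And>z. z \<in> S \<Longrightarrow> (\<lambda>n. h n z) sums H z"
    "\<And>z. z \<in> S \<Longrightarrow> (\<lambda>n. p z * u n z) sums H' z" "\<And>z. z \<in> S \<Longrightarrow> (H has_field_derivative H' z) (at z)"
    by blast
  show thesis
  proof
    show "(v has_field_derivative v' z) (at z)" if "z \<in> S" for z by (rule v(3) [OF that])
    show "(H has_field_derivative p z * v z) (at z)" if "z \<in> S" for z
      using H(3) [OF that] sums_unique2 [OF H(2) [OF that] sums_mult [OF v(1) [OF that]]] by metis
    show "(z - a) * (v' z - \<phi>' z) = q z * H z" if z: "z \<in> S" for z
    proof -
      \<comment> \<open>Dropping the zeroth term \<open>\<phi>'\<close> shifts the index by one, and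
        \<open>rel\<close> then identifies the series with \<open>q z\<close> times that of
        \<open>h\<close>.\<close>
      have "(\<lambda>n. u' (Suc n) z) sums (v' z - \<phi>' z)"
        using v(2) [OF z] by (subst sums_Suc_iff) (simp add: u0)
      from sums_mult [OF this, of "z - a"] have "(\<lambda>n. q z * h n z) sums ((z - a) * (v' z - \<phi>' z))"
        by (simp add: rel [OF z])
      with sums_mult [OF H(1) [OF z], of "q z"] show ?thesis using sums_unique2 by blast
    qed
    have "(\<lambda>n. u (Suc n) a) sums (v a - \<phi> a)"
      using v(1) [OF S(3)] by (subst sums_Suc_iff) (simp add: u0)
    then show "v a = \<phi> a" by (simp add: ua sums_iff)
  qed
qed

section \<open>The zonal equation in the variable sine of latitude\<close>

definition rho_sin :: "real \<Rightarrow> real \<Rightarrow> real" where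
  "rho_sin b x = sqrt (b\<^sup>2 + (1 - b\<^sup>2) * x\<^sup>2)"

lemma rho_sin_pos:
  assumes "0 < b" "b < 1"
  shows "0 < rho_sin b x"
proof -
  have "b\<^sup>2 \<le> 1" using assms by (simp add: power_le_one)
  then show ?thesis using assms by (auto simp: rho_sin_def intro!: add_pos_nonneg)
qed

lemma rho_sin_minus [simp]: "rho_sin b (- x) = rho_sin b x"
  by (simp add: rho_sin_def)

lemma rho_eq_rho_sin: "rho b \<theta> = rho_sin b (sin \<theta>)"
  by (simp add: rho_def rho_sin_def cos_squared_eq algebra_simps)

lemma continuous_on_rho_sin [continuous_intros]: "continuous_on S (rho_sin b)"
  unfolding rho_sin_def [abs_def] by (intro continuous_intros)

lemma has_real_derivative_Re_of_real:
  assumes "(f has_field_derivative f') (at (complex_of_real x))"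
  shows "((\<lambda>x. Re (f (of_real x))) has_real_derivative Re f') (at x)"
  unfolding has_real_derivative_iff_has_vector_derivative
  by (rule bounded_linear.has_vector_derivative [OF bounded_linear_Re])
     (rule has_vector_derivative_real_field [OF assms])

text \<open>The interval reaches beyond the pole \<open>x = 1\<close> so that a solution can be extended smoothly to
  the ambient space, as the smoothness required of elements of \<^const>\<open>eigsp\<close> demands.\<close>

lemma regular_solution_at_pole:
  fixes b \<mu> \<omega> c :: real
  assumes b: "0 < b" "b < 1"
  obtains D :: "nat \<Rightarrow> real \<Rightarrow> real"
  where "\<And>j x. x > -1 \<Longrightarrow> (D j has_real_derivative D (Suc j) x) (at x)" "D 0 1 = c"
    "\<And>x. x > -1 \<Longrightarrow> ((\<lambda>x. (1 - x\<^sup>2) / rho_sin b x * D 1 x) has_real_derivative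
        - \<mu> * rho_sin b x * D 0 x - 2 * \<omega> * x) (at x)"
proof -
  \<comment> \<open>\<open>Re z > -1\<close> leaves out the other pole;
    \<open>\<bar>Im z\<bar> < b\<close> keeps the radicand of \<open>\<rho>\<close> in the right
    half-plane, so that the principal root is holomorphic. As an intersection of half-planes the
    strip is convex.\<close>
  define S where "S = {z. -1 < Re z} \<inter> ({z. - b < Im z} \<inter> {z. Im z < b})"
  have S: "open S" "convex S" "1 \<in> S"
    using b by (auto simp: S_def open_halfspace_Re_gt open_halfspace_Im_gt open_halfspace_Im_lt
      convex_halfspace_Re_gt convex_halfspace_Im_gt convex_halfspace_Im_lt intro!: open_Int convex_Int)
  have realS: "complex_of_real x \<in> S" if "x > -1" for x
    using that b by (simp add: S_def)
  define \<rho> where "\<rho> z = csqrt (of_real (b\<^sup>2) + of_real (1 - b\<^sup>2) * z\<^sup>2)" for z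
  have b2: "0 < b\<^sup>2" "b\<^sup>2 < 1" using b by (auto simp: power_less_one_iff abs_square_less_1)
  have Re_pos: "0 < Re (of_real (b\<^sup>2) + of_real (1 - b\<^sup>2) * z\<^sup>2)" if "z \<in> S" for z
  proof -
    have "\<bar>Im z\<bar>\<^sup>2 < b\<^sup>2" using that by (intro power_strict_mono) (auto simp: S_def abs_less_iff)
    then have "(Im z)\<^sup>2 < b\<^sup>2" by simp
    moreover have "(1 - b\<^sup>2) * (Im z)\<^sup>2 \<le> (Im z)\<^sup>2" using b2 by (simp add: mult_le_cancel_right1 algebra_simps)
    moreover have "0 \<le> (1 - b\<^sup>2) * (Re z)\<^sup>2" using b2 by simp
    moreover have "Re (of_real (b\<^sup>2) + of_real (1 - b\<^sup>2) * z\<^sup>2)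
        = b\<^sup>2 + ((1 - b\<^sup>2) * (Re z)\<^sup>2 - (1 - b\<^sup>2) * (Im z)\<^sup>2)"
      by (simp add: power2_eq_square algebra_simps)
    ultimately show ?thesis by linarith
  qed
  have nonpos: "of_real (b\<^sup>2) + of_real (1 - b\<^sup>2) * z\<^sup>2 \<notin> \<real>\<^sub>\<le>\<^sub>0" if "z \<in> S" for z
    using Re_pos [OF that] by (auto simp: complex_nonpos_Reals_iff)
  have \<rho>_hol: "\<rho> holomorphic_on S"
    unfolding \<rho>_def [abs_def] using nonpos by (intro holomorphic_intros) auto
  have \<rho>_nz: "\<rho> z \<noteq> 0" if "z \<in> S" for z
  proof
    assume "\<rho> z = 0"
    then have "of_real (b\<^sup>2) + of_real (1 - b\<^sup>2) * z\<^sup>2 = 0"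
      by (simp only: \<rho>_def csqrt_eq_0)
    then show False using Re_pos [OF that] by simp
  qed
  have \<rho>_real: "\<rho> (of_real x) = of_real (rho_sin b x)" for x
  proof -
    have "0 \<le> b\<^sup>2 + (1 - b\<^sup>2) * x\<^sup>2" using b2 by simp
    then show ?thesis
      unfolding \<rho>_def rho_sin_def by (subst of_real_sqrt) simp_all
  qed
  have nz: "1 + z \<noteq> 0" if "z \<in> S" for z
  proof
    assume "1 + z = 0"
    then have "Re (1 + z) = 0" by simp
    then show False using that by (simp add: S_def)
  qed
  \<comment> \<open>The series starts at a primitive of \<open>\<omega> * \<rho>\<close>, normalised
    to \<open>c\<close> at 1: its derivative times (1 - z^2) / \<rho> is \<omega> (1 - z^2), whose
    derivative -2 \<omega> z is the forcing.\<close>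
  have "(\<lambda>z. of_real \<omega> * \<rho> z) holomorphic_on S"
    by (intro holomorphic_intros \<rho>_hol)
  from holomorphic_convex_primitive' [OF S(2,1) this]
  obtain F where F: "\<And>z. z \<in> S \<Longrightarrow> (F has_field_derivative of_real \<omega> * \<rho> z) (at z within S)"
    by metis
  have d\<phi>: "((\<lambda>z. of_real c + F z - F 1) has_field_derivative of_real \<omega> * \<rho> z) (at z)" if "z \<in> S" for z
  proof -
    have "(F has_field_derivative of_real \<omega> * \<rho> z) (at z)"
      using F [OF that] S(1) that by (metis at_within_open)
    then show ?thesis by (auto intro!: derivative_eq_intros)
  qed
  \<comment> \<open>Since 1 - z^2 = -(z - 1) (1 + z), these coefficients put the zonal equation into
    the singular Volterra form at \<open>a = 1\<close>.\<close>
  have p: "(\<lambda>z. of_real \<mu> * \<rho> z) holomorphic_on S" and q: "(\<lambda>z. \<rho> z / (1 + z)) holomorphic_on S"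
    by (intro holomorphic_intros \<rho>_hol nz; assumption)+
  obtain v v' H where v: "\<And>z. z \<in> S \<Longrightarrow> (v has_field_derivative v' z) (at z)"
    and H: "\<And>z. z \<in> S \<Longrightarrow> (H has_field_derivative (of_real \<mu> * \<rho> z) * v z) (at z)"
    and vH: "\<And>z. z \<in> S \<Longrightarrow> (z - 1) * (v' z - of_real \<omega> * \<rho> z) = \<rho> z / (1 + z) * H z"
    and v1: "v 1 = of_real c + F 1 - F 1"
    using regular_singular_solution [OF S p q d\<phi>] by metis
  \<comment> \<open>The right-hand side is differentiated through \<open>H\<close> alone, so no
    second derivative of \<open>v\<close> enters.\<close>
  have flux: "(1 - z\<^sup>2) / \<rho> z * v' z = of_real \<omega> * (1 - z\<^sup>2) - H z" if "z \<in> S" for z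
  proof -
    have "(1 + z) * ((z - 1) * (v' z - of_real \<omega> * \<rho> z)) = \<rho> z * H z"
      using vH [OF that] nz [OF that] by simp
    then have "(1 - z\<^sup>2) * v' z = \<rho> z * (of_real \<omega> * (1 - z\<^sup>2) - H z)"
      by (simp add: algebra_simps power2_eq_square)
    then show ?thesis using \<rho>_nz [OF that] by (simp add: field_simps)
  qed
  have hv: "v holomorphic_on S" using v S(1) holomorphic_on_open by blast
  \<comment> \<open>Holomorphy supplies all derivatives at once; taking real parts preserves the
    equation, whose coefficients are real on the real axis.\<close>
  define D where "D j x = Re ((deriv ^^ j) v (of_real x))" for j x
  show thesis
  proof
    fix x :: real assume x: "x > -1"
    show "(D j has_real_derivative D (Suc j) x) (at x)" for j
    proof -
      have "((deriv ^^ j) v has_field_derivative (deriv ^^ Suc j) v (of_real x)) (at (of_real x))"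
        using holomorphic_derivI [OF holomorphic_higher_deriv [OF hv S(1)] S(1) realS [OF x]] by simp
      then show ?thesis
        unfolding D_def [abs_def] by (rule has_real_derivative_Re_of_real)
    qed
    have "((\<lambda>z. of_real \<omega> * (1 - z\<^sup>2) - H z) has_field_derivative
        - (of_real \<mu> * \<rho> (of_real x)) * v (of_real x) - 2 * of_real \<omega> * of_real x) (at (of_real x))"
      using H [OF realS [OF x]] by (auto intro!: derivative_eq_intros)
    from has_real_derivative_Re_of_real [OF this]
    have *: "((\<lambda>x. Re (of_real \<omega> * (1 - (of_real x)\<^sup>2) - H (of_real x))) has_real_derivative
        - \<mu> * rho_sin b x * D 0 x - 2 * \<omega> * x) (at x)"
      by (simp add: \<rho>_real D_def)
    show "((\<lambda>x. (1 - x\<^sup>2) / rho_sin b x * D 1 x) has_real_derivative - \<mu> * rho_sin b x * D 0 x - 2 * \<omega> * x) (at x)"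
    proof (rule has_field_derivative_transform_within_open [OF * open_greaterThan])
      show "x \<in> {-1<..}" using x by simp
      fix y :: real assume "y \<in> {-1<..}"
      then have y: "complex_of_real y \<in> S" using realS by simp
      have "deriv v (of_real y) = v' (of_real y)" using v [OF y] by (rule DERIV_imp_deriv)
      moreover have "(1 - (complex_of_real y)\<^sup>2) / \<rho> (of_real y) = of_real ((1 - y\<^sup>2) / rho_sin b y)"
        by (simp add: \<rho>_real)
      ultimately have "of_real ((1 - y\<^sup>2) / rho_sin b y) * deriv v (of_real y)
          = of_real \<omega> * (1 - (complex_of_real y)\<^sup>2) - H (of_real y)"
        using flux [OF y] by (simp del: of_real_divide)
      from arg_cong [OF this, of Re] show "Re (of_real \<omega> * (1 - (of_real y)\<^sup>2) - H (of_real y)) = (1 - y\<^sup>2) / rho_sin b y * D 1 y"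
        by (simp add: D_def del: of_real_divide)
    qed
  next
    show "D 0 1 = c" using v1 by (simp add: D_def)
  qed
qed

section \<open>Uniqueness at the regular point 0 and odd reflection\<close>

text \<open>A Gronwall argument: the derivative of \<open>d\<^sup>2 + e\<^sup>2\<close> is
  \<open>2 * (\<alpha> + \<beta>) * d * e\<close>, at most
  \<open>B * (d\<^sup>2 + e\<^sup>2)\<close>, so
  \<open>(d\<^sup>2 + e\<^sup>2) * exp (- B * x)\<close> cannot grow from 0.\<close>

lemma linear_system_zero:
  fixes d e :: "real \<Rightarrow> real"
  assumes "0 \<le> R" "d 0 = 0" "e 0 = 0"
    and d: "\<And>x. x \<in> {0..R} \<Longrightarrow> (d has_real_derivative \<alpha> x * e x) (at x)"
    and e: "\<And>x. x \<in> {0..R} \<Longrightarrow> (e has_real_derivative \<beta> x * d x) (at x)"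
    and B: "\<And>x. x \<in> {0..R} \<Longrightarrow> \<bar>\<alpha> x + \<beta> x\<bar> \<le> B"
  shows "d R = 0"
proof -
  define N where "N x = ((d x)\<^sup>2 + (e x)\<^sup>2) * exp (- B * x)" for x
  have "N R \<le> N 0"
  proof (rule DERIV_nonpos_imp_nonincreasing [OF assms(1)])
    fix x assume "0 \<le> x" "x \<le> R"
    then have x: "x \<in> {0..R}" by simp
    have "(N has_real_derivative
        (2 * d x * (\<alpha> x * e x) + 2 * e x * (\<beta> x * d x)) * exp (- B * x)
         + ((d x)\<^sup>2 + (e x)\<^sup>2) * (exp (- B * x) * (- B))) (at x)"
      unfolding N_def [abs_def] by (auto intro!: derivative_eq_intros d e x)
    moreover have "(\<alpha> x + \<beta> x) * (2 * d x * e x) \<le> B * ((d x)\<^sup>2 + (e x)\<^sup>2)"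
    proof -
      have "(\<alpha> x + \<beta> x) * (2 * d x * e x) \<le> \<bar>\<alpha> x + \<beta> x\<bar> * \<bar>2 * d x * e x\<bar>"
        by (metis abs_ge_self abs_mult)
      also have "\<bar>2 * d x * e x\<bar> \<le> (d x)\<^sup>2 + (e x)\<^sup>2"
        using sum_squares_bound [of "\<bar>d x\<bar>" "\<bar>e x\<bar>"] by (simp add: abs_mult)
      then have "\<bar>\<alpha> x + \<beta> x\<bar> * \<bar>2 * d x * e x\<bar> \<le> B * ((d x)\<^sup>2 + (e x)\<^sup>2)"
        using B [OF x] by (intro mult_mono) auto
      finally show ?thesis .
    qed
    then have "((\<alpha> x + \<beta> x) * (2 * d x * e x) - B * ((d x)\<^sup>2 + (e x)\<^sup>2)) * exp (- B * x) \<le> 0"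
      by (intro mult_nonpos_nonneg) auto
    ultimately show "\<exists>y. (N has_real_derivative y) (at x) \<and> y \<le> 0"
      by (intro exI conjI) (auto simp: algebra_simps)
  qed
  then have "(d R)\<^sup>2 + (e R)\<^sup>2 \<le> 0"
    using assms(2,3) by (simp add: N_def mult_le_0_iff)
  then show ?thesis by (metis add_nonneg_nonneg antisym sum_power2_eq_zero_iff zero_le_power2)
qed

text \<open>As \<open>rho_sin\<close> is even and the forcing odd, the map u(x) -> -u(-x) preserves
  solutions. Uniqueness at 0 makes a solution vanishing there odd on (-1, 1), and reflection
  transports its regularity at 1 to -1.\<close>

lemma odd_extension:
  fixes D :: "nat \<Rightarrow> real \<Rightarrow> real"
  assumes b: "0 < b" "b < 1"
    and D: "\<And>j x. x > -1 \<Longrightarrow> (D j has_real_derivative D (Suc j) x) (at x)"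
    and D0: "D 0 0 = 0"
    and flux: "\<And>x. x > -1 \<Longrightarrow> ((\<lambda>x. (1 - x\<^sup>2) / rho_sin b x * D 1 x) has_real_derivative
        - \<mu> * rho_sin b x * D 0 x - 2 * \<omega> * x) (at x)"
  obtains E :: "nat \<Rightarrow> real \<Rightarrow> real"
  where "\<forall>j x. (E j has_real_derivative E (Suc j) x) (at x)" "\<forall>j. \<forall>x>-1. E j x = D j x"
    "\<forall>x>-1. ((\<lambda>x. (1 - x\<^sup>2) / rho_sin b x * E 1 x) has_real_derivative
        - \<mu> * rho_sin b x * E 0 x - 2 * \<omega> * x) (at x)"
proof -
  define d where "d j x = D j x + (-1) ^ j * D j (- x)" for j x
  have dD: "(d j has_real_derivative d (Suc j) x) (at x)" if "x \<in> {-1<..<1}" for j x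
    unfolding d_def [abs_def] using that
    by (auto intro!: derivative_eq_intros D DERIV_chain2 [OF D])
  \<comment> \<open>\<open>d 0\<close> is twice the even part of \<open>D 0\<close>, and
    \<open>e\<close> is its flux. In the difference the odd forcing terms cancel, so the system for
    \<open>d 0\<close> and \<open>e\<close> is homogeneous; \<open>e 0 = 0\<close> holds by
    construction.\<close>
  define e where "e x = (1 - x\<^sup>2) / rho_sin b x * D 1 x - (1 - (-x)\<^sup>2) / rho_sin b (-x) * D 1 (-x)" for x
  have de: "(e has_real_derivative (- \<mu> * rho_sin b x) * d 0 x) (at x)" if "x \<in> {-1<..<1}" for x
    unfolding e_def [abs_def]
    by (rule DERIV_cong, rule DERIV_diff [OF flux DERIV_chain2 [OF flux DERIV_minus [OF DERIV_ident]]])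
       (use that in \<open>auto simp: d_def algebra_simps\<close>)
  have d1: "d 1 x = rho_sin b x / (1 - x\<^sup>2) * e x" if "x \<in> {-1<..<1}" for x
  proof -
    have "1 - x\<^sup>2 \<noteq> 0" using that by (auto simp: power2_eq_1_iff)
    moreover have "e x = (1 - x\<^sup>2) / rho_sin b x * d 1 x"
      by (simp add: e_def d_def algebra_simps diff_divide_distrib add_divide_distrib)
    ultimately show ?thesis using rho_sin_pos [OF b, of x] by simp
  qed
  \<comment> \<open>The coefficient \<open>rho_sin b x / (1 - x\<^sup>2)\<close> blows up at 1, so
    it is bounded on each \<open>{0..R}\<close> with \<open>R < 1\<close> separately.\<close>
  have pos: "d 0 R = 0" if R: "0 \<le> R" "R < 1" for R
  proof -
    have "continuous_on {0..R} (\<lambda>x. rho_sin b x / (1 - x\<^sup>2) + - \<mu> * rho_sin b x)"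
      using R by (intro continuous_intros) (auto simp: power2_eq_1_iff)
    then have "bounded ((\<lambda>x. rho_sin b x / (1 - x\<^sup>2) + - \<mu> * rho_sin b x) ` {0..R})"
      by (intro compact_imp_bounded compact_continuous_image) auto
    then obtain B where "\<forall>x\<in>{0..R}. \<bar>rho_sin b x / (1 - x\<^sup>2) + - \<mu> * rho_sin b x\<bar> \<le> B"
      by (auto simp: bounded_iff)
    then have B: "\<bar>rho_sin b x / (1 - x\<^sup>2) + - \<mu> * rho_sin b x\<bar> \<le> B" if "x \<in> {0..R}" for x
      using that by blast
    have d0: "(d 0 has_real_derivative rho_sin b x / (1 - x\<^sup>2) * e x) (at x)" if "x \<in> {0..R}" for x
      using dD [of x 0] d1 [of x] that R by simp
    have e0: "(e has_real_derivative (- \<mu> * rho_sin b x) * d 0 x) (at x)" if "x \<in> {0..R}" for x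
      using that R by (intro de) simp
    show ?thesis
      by (rule linear_system_zero [OF R(1) _ _ d0 e0 B]) (simp_all add: d_def D0 e_def)
  qed
  have dj: "d j x = 0" if "x \<in> {-1<..<1}" for j x
    using that
  proof (induction j arbitrary: x)
    case 0
    have "d 0 x = d 0 \<bar>x\<bar>" by (simp add: d_def abs_if)
    with 0 pos [of "\<bar>x\<bar>"] show ?case by (auto simp: abs_less_iff)
  next
    case (Suc j)
    have "((\<lambda>_. 0) has_real_derivative d (Suc j) x) (at x)"
      by (rule has_field_derivative_transform_within_open [OF dD [OF Suc.prems], of "{-1<..<1}"])
         (use Suc in auto)
    then show ?case using DERIV_unique DERIV_const by blast
  qed
  \<comment> \<open>The second branch is the j-th derivative of \<open>- D 0 (- x)\<close>, whence
    the exponent \<open>Suc j\<close>. By oddness both formulas agree on (-1, 1), so each point lies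
    in an open half-line on which one of them holds.\<close>
  define E where "E j x = (if x > -1 then D j x else (-1) ^ Suc j * D j (- x))" for j x
  have E1: "E j x = D j x" if "x > -1" for j x using that by (simp add: E_def)
  have E2: "E j x = (-1) ^ Suc j * D j (- x)" if "x < 1" for j x
    using that dj [of x j] by (auto simp: E_def d_def)
  show thesis
  proof (rule that; intro allI impI)
    show "E j x = D j x" if "x > -1" for j x by (rule E1 [OF that])
    show "((\<lambda>x. (1 - x\<^sup>2) / rho_sin b x * E 1 x) has_real_derivative
        - \<mu> * rho_sin b x * E 0 x - 2 * \<omega> * x) (at x)" if "x > -1" for x
      unfolding E1 [OF that]
      by (rule has_field_derivative_transform_within_open [OF flux [OF that] open_greaterThan])
         (use that E1 in auto)
    show "(E j has_real_derivative E (Suc j) x) (at x)" for j x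
    proof (cases "x > -1")
      case True
      show ?thesis
        by (rule has_field_derivative_transform_within_open [where S = "{-1<..}" and f = "D j"])
           (use True D E1 in auto)
    next
      case False
      then have x: "- x > -1" by simp
      have "((\<lambda>x. D j (- x)) has_real_derivative D (Suc j) (- x) * - 1) (at x)"
        by (rule DERIV_chain2 [OF D [OF x] DERIV_minus [OF DERIV_ident]])
      from DERIV_cmult [OF this, of "(-1) ^ Suc j"]
      have "((\<lambda>x. (-1) ^ Suc j * D j (- x)) has_real_derivative E (Suc j) x) (at x)"
        using False E2 [of x "Suc j"] by simp
      then show ?thesis
        by (rule has_field_derivative_transform_within_open [where S = "{..<1}"])
           (use False E2 in auto)
    qed
  qed
qed

section \<open>Zonal functions on the ellipsoid\<close>

text \<open>On the ellipsoid the third coordinate over \<open>b\<close> is sin \<theta>, so this is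
  the ambient extension of a zonal function. A directional derivative has the same shape with a new
  factor and \<open>Suc j\<close>; hence the free \<open>c\<close> and \<open>j\<close> in the
  induction.\<close>

lemma Cn_zonal:
  fixes E :: "nat \<Rightarrow> real \<Rightarrow> real"
  assumes E: "\<And>j x. (E j has_real_derivative E (Suc j) x) (at x)"
  shows "Cn n (\<lambda>p :: real \<times> real \<times> real. complex_of_real (c * E j (snd (snd p) / b)))"
proof (induction n arbitrary: c j)
  case 0
  have "continuous_on UNIV (E j)"
    using E by (meson DERIV_isCont continuous_at_imp_continuous_on)
  then have "continuous_on UNIV (\<lambda>p :: real \<times> real \<times> real. E j (snd (snd p) * inverse b))"
    by (rule continuous_on_compose2) (intro continuous_intros, simp)
  then have "continuous_on UNIV (\<lambda>p :: real \<times> real \<times> real. complex_of_real (c * E j (snd (snd p) * inverse b)))"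
    by (intro continuous_on_of_real continuous_on_mult continuous_on_const)
  then show ?case by (simp add: divide_inverse)
next
  case (Suc n)
  let ?f' = "\<lambda>(x :: real \<times> real \<times> real) v :: real \<times> real \<times> real.
    complex_of_real (c * snd (snd v) / b * E (Suc j) (snd (snd x) / b))"
  have "((\<lambda>p. complex_of_real (c * E j (snd (snd p) / b))) has_derivative ?f' x) (at x)" for x
  proof -
    have l: "((\<lambda>p :: real \<times> real \<times> real. snd (snd p) / b) has_derivative (\<lambda>v. snd (snd v) / b)) (at x)"
      unfolding divide_inverse
      by (intro has_derivative_mult_left has_derivative_snd has_derivative_ident)
    have "((\<lambda>p. E j (snd (snd p) / b)) has_derivative (\<lambda>v. E (Suc j) (snd (snd x) / b) * (snd (snd v) / b))) (at x)"
      using has_derivative_compose [OF l E [unfolded has_field_derivative_def]] by simp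
    then have "((\<lambda>p. complex_of_real (c * E j (snd (snd p) / b))) has_derivative
        (\<lambda>v. of_real (c * (E (Suc j) (snd (snd x) / b) * (snd (snd v) / b))))) (at x)"
      by (intro has_derivative_of_real has_derivative_mult_right)
    then show ?thesis by (simp add: mult_ac)
  qed
  then show ?case
    unfolding Cn.simps by (intro exI [of _ ?f'] conjI allI Suc.IH)
qed

text \<open>Both derivatives are choices from the same set of admissible values, so they coincide
  even where \<open>f\<close> is not differentiable. Equality as functions allows rewriting inside
  the nested \<open>d_phi\<close> of \<open>lap\<close>.\<close>

lemma d_phi_add_zonal: "d_phi (\<lambda>p t. c t + f p t) = d_phi f"
proof -
  have "((\<lambda>p. c t + f p t) has_vector_derivative D) (at x) \<longleftrightarrow>
      ((\<lambda>p. f p t) has_vector_derivative D) (at x)" for t x D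
    using has_vector_derivative_add_const [of "\<lambda>p. f p t" "c t"] by (simp add: add.commute)
  then show ?thesis
    unfolding d_phi_def [abs_def] vector_derivative_def by simp
qed

text \<open>In x = sin \<theta>, \<open>cos \<theta> / rho b \<theta>\<close> times the
  \<theta>-derivative of the zonal part is the flux of \<open>E 0\<close>, so \<open>flux\<close>
  evaluates its Laplacian. \<open>Y\<close> comes with two \<theta>-derivatives because additivity
  of the total operator \<open>d_theta\<close> rests on their existence.\<close>

lemma lap_zonal_add:
  fixes E :: "nat \<Rightarrow> real \<Rightarrow> real" and Y Z Z' :: "real \<Rightarrow> real \<Rightarrow> complex"
  assumes b: "0 < b" "b < 1"
    and E: "\<And>j x. (E j has_real_derivative E (Suc j) x) (at x)"
    and flux: "\<And>x. x > -1 \<Longrightarrow> ((\<lambda>x. (1 - x\<^sup>2) / rho_sin b x * E 1 x) has_real_derivative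
        - \<mu> * rho_sin b x * E 0 x - 2 * \<omega> * x) (at x)"
    and Y: "\<And>t. t \<in> {-pi/2<..<pi/2} \<Longrightarrow> (Y \<phi> has_vector_derivative Z \<phi> t) (at t)"
    and Z: "\<And>t. t \<in> {-pi/2<..<pi/2} \<Longrightarrow> (Z \<phi> has_vector_derivative Z' \<phi> t) (at t)"
    and \<theta>: "\<theta> \<in> {-pi/2<..<pi/2}"
  shows "lap b (\<lambda>p t. complex_of_real (E 0 (sin t)) + Y p t) \<phi> \<theta>
     = of_real (- \<mu> * E 0 (sin \<theta>) - 2 * \<omega> * sin \<theta> / rho b \<theta>) + lap b Y \<phi> \<theta>"
proof -
  let ?I = "{-pi/2<..<pi/2}"
  define \<psi> where "\<psi> = (\<lambda>p t. complex_of_real (E 0 (sin t)) + Y p t)"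
  define Q where "Q x = (1 - x\<^sup>2) / rho_sin b x * E 1 x" for x
  define q where "q = - \<mu> * rho_sin b (sin \<theta>) * E 0 (sin \<theta>) - 2 * \<omega> * sin \<theta>"
  have rnz: "rho_sin b x \<noteq> 0" for x using rho_sin_pos [OF b, of x] by simp
  have cos_pos: "0 < cos t" if "t \<in> ?I" for t
    using that by (intro cos_gt_zero_pi) auto
  have sin_gt: "- 1 < sin t" if "t \<in> ?I" for t
  proof -
    have "(sin t)\<^sup>2 < 1" using cos_pos [OF that] by (simp add: sin_squared_eq)
    then show ?thesis using abs_square_less_1 [of "sin t"] by (simp add: abs_less_iff)
  qed
  have dE: "((\<lambda>t. complex_of_real (E 0 (sin t))) has_vector_derivative
      of_real (E 1 (sin t) * cos t)) (at t)" for t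
    by (intro has_vector_derivative_of_real)
       (use DERIV_chain2 [OF E [of 0] DERIV_sin] in \<open>simp add: has_real_derivative_iff_has_vector_derivative\<close>)
  have d\<psi>: "d_theta \<psi> \<phi> t = of_real (E 1 (sin t) * cos t) + Z \<phi> t" if "t \<in> ?I" for t
    unfolding d_theta_def \<psi>_def
    by (rule vector_derivative_at [OF has_vector_derivative_add [OF dE Y [OF that]]])
  have dY: "d_theta Y \<phi> t = Z \<phi> t" if "t \<in> ?I" for t
    unfolding d_theta_def using Y [OF that] by (rule vector_derivative_at)
  have "((\<lambda>t. Q (sin t)) has_real_derivative q * cos \<theta>) (at \<theta>)"
    unfolding Q_def [abs_def] q_def
    by (rule DERIV_chain2 [OF flux DERIV_sin]) (use sin_gt \<theta> in auto)
  then have dQ: "((\<lambda>t. complex_of_real (Q (sin t))) has_vector_derivative of_real (q * cos \<theta>)) (at \<theta>)"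
    by (intro has_vector_derivative_of_real) (simp add: has_real_derivative_iff_has_vector_derivative)
  have "\<exists>k. ((\<lambda>t. cos t / rho b t) has_real_derivative k) (at \<theta>)"
  proof -
    have "0 < b\<^sup>2 + (1 - b\<^sup>2) * (sin \<theta>)\<^sup>2"
      using rho_sin_pos [OF b, of "sin \<theta>"] by (simp add: rho_sin_def)
    then show ?thesis
      unfolding rho_eq_rho_sin rho_sin_def
      by (intro exI) (rule derivative_eq_intros refl | simp)+
  qed
  then obtain k where "((\<lambda>t. cos t / rho b t) has_real_derivative k) (at \<theta>)" ..
  then have k: "((\<lambda>t. complex_of_real (cos t / rho b t)) has_vector_derivative of_real k) (at \<theta>)"
    by (intro has_vector_derivative_of_real) (simp add: has_real_derivative_iff_has_vector_derivative)
  \<comment> \<open>\<open>X\<close> stays anonymous: it contributes equally to the Laplacians of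
    \<open>\<psi>\<close> and \<open>Y\<close>.\<close>
  obtain X where X: "((\<lambda>t. complex_of_real (cos t / rho b t) * Z \<phi> t) has_vector_derivative X) (at \<theta>)"
    using has_vector_derivative_mult [OF k Z [OF \<theta>]] by blast
  have "((\<lambda>t. complex_of_real (cos t / rho b t) * d_theta \<psi> \<phi> t) has_vector_derivative
      of_real (q * cos \<theta>) + X) (at \<theta>)"
  proof (rule has_vector_derivative_transform_within_open [OF has_vector_derivative_add [OF dQ X], of ?I])
    fix t assume t: "t \<in> ?I"
    have "Q (sin t) = cos t / rho b t * (E 1 (sin t) * cos t)"
      unfolding Q_def rho_eq_rho_sin cos_squared_eq [symmetric] by (simp add: power2_eq_square)
    then show "of_real (Q (sin t)) + complex_of_real (cos t / rho b t) * Z \<phi> t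
        = complex_of_real (cos t / rho b t) * d_theta \<psi> \<phi> t"
      by (simp add: d\<psi> [OF t] distrib_left)
  qed (use \<theta> in auto)
  then have 1: "d_theta (\<lambda>p t. complex_of_real (cos t / rho b t) * d_theta \<psi> p t) \<phi> \<theta>
      = of_real (q * cos \<theta>) + X"
    unfolding d_theta_def [of "\<lambda>p t. complex_of_real (cos t / rho b t) * d_theta \<psi> p t"]
    by (rule vector_derivative_at)
  have "((\<lambda>t. complex_of_real (cos t / rho b t) * d_theta Y \<phi> t) has_vector_derivative X) (at \<theta>)"
    by (rule has_vector_derivative_transform_within_open [OF X, of ?I]) (use \<theta> dY in auto)
  then have 2: "d_theta (\<lambda>p t. complex_of_real (cos t / rho b t) * d_theta Y p t) \<phi> \<theta> = X"
    unfolding d_theta_def [of "\<lambda>p t. complex_of_real (cos t / rho b t) * d_theta Y p t"]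
    by (rule vector_derivative_at)
  have 3: "complex_of_real (1 / (cos \<theta> * rho b \<theta>)) * of_real (q * cos \<theta>)
      = of_real (- \<mu> * E 0 (sin \<theta>) - 2 * \<omega> * sin \<theta> / rho b \<theta>)"
    unfolding of_real_mult [symmetric] using cos_pos [OF \<theta>] rnz [of "sin \<theta>"]
    by (intro arg_cong [of _ _ of_real]) (simp add: q_def rho_eq_rho_sin field_simps)
  have "d_phi \<psi> = d_phi Y"
    unfolding \<psi>_def by (rule d_phi_add_zonal)
  then show ?thesis
    unfolding \<psi>_def [symmetric] lap_def 1 2 by (simp only: distrib_left 3 add_ac)
qed

text \<open>Serves to rule out a homogeneous solution vanishing at the equator. It is
  \<open>lap_zonal_add\<close> with \<open>Y\<close> and \<open>\<omega>\<close> zero;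
  \<open>E\<close> lives on the whole line to give a smooth ambient extension.\<close>

lemma zonal_eigenfunction:
  fixes E :: "nat \<Rightarrow> real \<Rightarrow> real"
  assumes b: "0 < b" "b < 1"
    and E: "\<And>j x. (E j has_real_derivative E (Suc j) x) (at x)"
    and flux: "\<And>x. x > -1 \<Longrightarrow> ((\<lambda>x. (1 - x\<^sup>2) / rho_sin b x * E 1 x) has_real_derivative
        - \<mu> * rho_sin b x * E 0 x) (at x)"
  shows "(\<lambda>\<phi> \<theta>. complex_of_real (E 0 (sin \<theta>))) \<in> eigsp b \<mu>"
  unfolding eigsp_def mem_Collect_eq
proof (intro conjI allI impI)
  show "smooth_S2 b (\<lambda>\<phi> \<theta>. complex_of_real (E 0 (sin \<theta>)))"
    unfolding smooth_S2_def smooth_map_def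
    using Cn_zonal [where E = E, OF E, of _ 1 0 b] b
    by (intro exI [of _ "\<lambda>p. complex_of_real (1 * E 0 (snd (snd p) / b))"]) (simp add: ell_pt_def)
  fix \<phi> \<theta> :: real assume \<theta>: "\<theta> \<in> {-pi/2<..<pi/2}"
  have "lap b (\<lambda>p t. complex_of_real (E 0 (sin t)) + 0) \<phi> \<theta>
     = of_real (- \<mu> * E 0 (sin \<theta>) - 2 * 0 * sin \<theta> / rho b \<theta>) + lap b (\<lambda>p t. 0) \<phi> \<theta>"
    by (rule lap_zonal_add [where E = E and Z = "\<lambda>_ _. 0" and Z' = "\<lambda>_ _. 0", OF b E _ _ _ \<theta>]) (use flux in auto)
  then show "- lap b (\<lambda>\<phi> \<theta>. complex_of_real (E 0 (sin \<theta>))) \<phi> \<theta> = of_real \<mu> * of_real (E 0 (sin \<theta>))"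
    by (simp add: lap_def d_phi_def d_theta_def)
qed

section \<open>Hoelder regularity of the zonal profile\<close>

text \<open>On [-a, a] a bound on \<open>g4\<close> makes \<open>g3\<close> Lipschitz; splitting
  \<open>\<bar>x - y\<bar>\<close> into two square roots, one of them at most
  \<open>sqrt (2 * a)\<close>, trades this for exponent 1/2.\<close>

lemma C3_alpha_half:
  fixes g0 g1 g2 g3 g4 :: "real \<Rightarrow> real"
  assumes "\<And>x. (g0 has_real_derivative g1 x) (at x)" "\<And>x. (g1 has_real_derivative g2 x) (at x)"
    "\<And>x. (g2 has_real_derivative g3 x) (at x)" "\<And>x. (g3 has_real_derivative g4 x) (at x)"
    "continuous_on UNIV g4"
  shows "C3_alpha (1/2) I g0"
proof -
  have d: "deriv g0 = g1" "deriv g1 = g2" "deriv g2 = g3"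
    using assms by (auto intro!: ext DERIV_imp_deriv)
  have g3: "(deriv ^^ 3) g0 = g3" by (simp add: numeral_3_eq_3 d)
  show ?thesis
    unfolding C3_alpha_def g3
  proof (intro conjI allI impI ballI)
    fix k :: nat and x assume "k < 3"
    then consider "k = 0" | "k = 1" | "k = 2" by linarith
    then show "(deriv ^^ k) g0 differentiable (at x)"
      using assms(1-3) by cases (auto simp: numeral_2_eq_2 d real_differentiable_def)
  next
    fix K assume "compact K \<and> K \<subseteq> I"
    then have "bounded K" by (simp add: compact_imp_bounded)
    then obtain a where a: "\<And>x. x \<in> K \<Longrightarrow> \<bar>x\<bar> \<le> a" by (auto simp: bounded_iff)
    have "bounded (g4 ` {-a..a})"
      using assms(5) by (intro compact_imp_bounded compact_continuous_image)
        (auto intro: continuous_on_subset)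
    then obtain M where M: "\<And>x. x \<in> {-a..a} \<Longrightarrow> \<bar>g4 x\<bar> \<le> M"
      unfolding bounded_iff by (metis image_eqI real_norm_def)
    have "\<bar>g3 x - g3 y\<bar> \<le> M * sqrt (2 * a) * \<bar>x - y\<bar> powr (1/2)" if "x \<in> K" "y \<in> K" for x y
    proof -
      have xy: "x \<in> {-a..a}" "y \<in> {-a..a}" using a that by (auto simp: abs_le_iff) force+
      have "norm (g3 x - g3 y) \<le> M * norm (x - y)"
        by (rule field_differentiable_bound [OF convex_real_interval(5) _ _ xy])
           (use M in \<open>auto intro: has_field_derivative_at_within [OF assms(4)]\<close>)
      also have "norm (x - y) = sqrt \<bar>x - y\<bar> * sqrt \<bar>x - y\<bar>" by simp
      also have "M * (sqrt \<bar>x - y\<bar> * sqrt \<bar>x - y\<bar>) \<le> M * (sqrt (2 * a) * sqrt \<bar>x - y\<bar>)"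
        using xy M [of x] by (intro mult_left_mono mult_right_mono real_sqrt_le_mono) auto
      finally show ?thesis by (simp add: powr_half_sqrt mult_ac)
    qed
    then show "\<exists>C. \<forall>x\<in>K. \<forall>y\<in>K. \<bar>g3 x - g3 y\<bar> \<le> C * \<bar>x - y\<bar> powr (1/2)" by blast
  qed
qed

lemma C3_alpha_comp_sin:
  fixes E :: "nat \<Rightarrow> real \<Rightarrow> real"
  assumes E: "\<And>j x. (E j has_real_derivative E (Suc j) x) (at x)"
  shows "C3_alpha (1/2) I (\<lambda>t. E 0 (sin t))"
proof -
  have dE: "((\<lambda>t. E j (sin t)) has_real_derivative E (Suc j) (sin t) * cos t) (at t)" for j t
    by (rule DERIV_chain2 [OF E DERIV_sin])
  have cE: "continuous_on UNIV (\<lambda>t. E j (sin t))" for j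
    using dE by (meson DERIV_isCont continuous_at_imp_continuous_on)
  show ?thesis
  proof (rule C3_alpha_half)
    show "((\<lambda>t. E 0 (sin t)) has_real_derivative E 1 (sin t) * cos t) (at t)" for t
      using dE [of 0] by simp
    show "((\<lambda>t. E 1 (sin t) * cos t) has_real_derivative
        E 2 (sin t) * (cos t)\<^sup>2 - E 1 (sin t) * sin t) (at t)" for t
      by (rule derivative_eq_intros dE refl)+
         (simp add: numeral_2_eq_2 algebra_simps)
    show "((\<lambda>t. E 2 (sin t) * (cos t)\<^sup>2 - E 1 (sin t) * sin t) has_real_derivative
        E 3 (sin t) * cos t ^ 3 - 3 * E 2 (sin t) * sin t * cos t - E 1 (sin t) * cos t) (at t)" for t
      by (rule derivative_eq_intros dE refl)+
         (simp add: eval_nat_numeral algebra_simps)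
    show "((\<lambda>t. E 3 (sin t) * cos t ^ 3 - 3 * E 2 (sin t) * sin t * cos t - E 1 (sin t) * cos t)
        has_real_derivative E 4 (sin t) * cos t ^ 4 - 6 * E 3 (sin t) * sin t * (cos t)\<^sup>2
          - 4 * E 2 (sin t) * (cos t)\<^sup>2 + 3 * E 2 (sin t) * (sin t)\<^sup>2 + E 1 (sin t) * sin t) (at t)" for t
      by (rule derivative_eq_intros dE refl)+
         (simp add: eval_nat_numeral algebra_simps)
    show "continuous_on UNIV (\<lambda>t. E 4 (sin t) * cos t ^ 4 - 6 * E 3 (sin t) * sin t * (cos t)\<^sup>2
          - 4 * E 2 (sin t) * (cos t)\<^sup>2 + 3 * E 2 (sin t) * (sin t)\<^sup>2 + E 1 (sin t) * sin t)"
      by (intro continuous_intros cE)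
  qed
qed

section \<open>Construction of the zonal profile and the Euler equations\<close>

theorem theorem1:
  fixes b \<omega> :: real and l :: nat and m :: int and Y :: "real \<Rightarrow> real \<Rightarrow> complex"
  assumes "0 < b" "b < 1"
    and "m \<in> {- int l..int l}" "m \<noteq> 0"
    and "has_ONB_modes b l m"
    and "Y \<in> E b l m"
  shows "\<exists>\<alpha>\<in>{0<..<1}. \<exists>g :: real \<Rightarrow> real.
     C3_alpha \<alpha> {-pi/2<..<pi/2} g
   \<and> (\<forall>\<theta>\<in>{-pi/2<..<pi/2}.
        - lam b l m * g \<theta> =
          1 / (cos \<theta> * rho b \<theta>) * deriv (\<lambda>t. cos t / rho b t * deriv g t) \<theta>
          + 2 * \<omega> * sin \<theta> / rho b \<theta>)
   \<and> (deriv g \<longlongrightarrow> 0) (at_left (pi/2))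
   \<and> (deriv g \<longlongrightarrow> 0) (at_right (-pi/2))
   \<and> (let \<psi> = (\<lambda>\<phi> \<theta>. complex_of_real (g \<theta>) + Y \<phi> \<theta>);
         W = (\<lambda>\<phi> \<theta>. lap b \<psi> \<phi> \<theta> + complex_of_real (2 * \<omega> * sin \<theta> / rho b \<theta>)) in
      \<forall>\<phi> \<theta>. \<theta> \<in> {-pi/2<..<pi/2} \<longrightarrow>
        - d_theta \<psi> \<phi> \<theta> * d_phi W \<phi> \<theta> + d_phi \<psi> \<phi> \<theta> * d_theta W \<phi> \<theta> = 0)"
proof -
  note b = assms(1,2)
  let ?I = "{-pi/2<..<pi/2}"
  define \<mu> where "\<mu> = lam b l m"
  obtain y1 y2 :: "real \<Rightarrow> complex" where y: "smooth_fun y1 {-pi/2..pi/2}" "smooth_fun y2 {-pi/2..pi/2}"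
    and span: "\<And>\<psi>. \<psi> \<in> eigsp b \<mu> \<Longrightarrow> \<exists>c1 c2. \<forall>\<phi> \<theta>. \<theta> \<in> {-pi/2..pi/2} \<longrightarrow>
         \<psi> \<phi> \<theta> = c1 * (y1 \<theta> * cis (of_int m * \<phi>)) + c2 * (y2 \<theta> * cis (- of_int m * \<phi>))"
    using assms(5) unfolding has_ONB_modes_def Let_def \<mu>_def by blast
  \<comment> \<open>The shift of \<open>\<phi>\<close> by \<open>pi / m\<close> reverses the sign of both basis modes but fixes zonal functions.\<close>
  have no_zonal: "f \<theta> = 0" if "(\<lambda>\<phi>. f) \<in> eigsp b \<mu>" "\<theta> \<in> {-pi/2..pi/2}" for f :: "real \<Rightarrow> complex" and \<theta>
  proof -
    from span [OF that(1)] that(2) obtain c1 c2 where eq: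
      "\<And>\<phi>. f \<theta> = c1 * (y1 \<theta> * cis (of_int m * \<phi>)) + c2 * (y2 \<theta> * cis (- of_int m * \<phi>))" by blast
    have "cis (- pi) = - 1" by (simp add: complex_eq_iff)
    then have "f \<theta> = - f \<theta>"
      using eq [of 0] eq [of "pi / of_int m"] assms(4) by simp
    then show ?thesis by simp
  qed
  \<comment> \<open>A homogeneous solution, normalised at the pole so as not to vanish identically;
    \<open>U\<close> below is a particular solution with the arbitrary value 0 there.\<close>
  obtain V where V: "\<And>j x. x > -1 \<Longrightarrow> (V j has_real_derivative V (Suc j) x) (at x)" "V 0 1 = 1"
    "\<And>x. x > -1 \<Longrightarrow> ((\<lambda>x. (1 - x\<^sup>2) / rho_sin b x * V 1 x) has_real_derivative
        - \<mu> * rho_sin b x * V 0 x - 2 * 0 * x) (at x)"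
    by (rule regular_solution_at_pole [OF b, where c = 1 and \<omega> = 0 and \<mu> = \<mu>]) blast
  obtain U where U: "\<And>j x. x > -1 \<Longrightarrow> (U j has_real_derivative U (Suc j) x) (at x)"
    "\<And>x. x > -1 \<Longrightarrow> ((\<lambda>x. (1 - x\<^sup>2) / rho_sin b x * U 1 x) has_real_derivative
        - \<mu> * rho_sin b x * U 0 x - 2 * \<omega> * x) (at x)"
    by (rule regular_solution_at_pole [OF b, where c = 0 and \<omega> = \<omega> and \<mu> = \<mu>]) blast
  \<comment> \<open>Otherwise the odd extension of \<open>V 0\<close> would be a zonal eigenfunction
    with value 1 at \<theta> = pi/2, against \<open>no_zonal\<close>.\<close>
  have V0: "V 0 0 \<noteq> 0"
  proof
    assume V00: "V 0 0 = 0"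
    from odd_extension [where D = V, OF b V(1) V00 V(3)] obtain F :: "nat \<Rightarrow> real \<Rightarrow> real"
      where "\<forall>j x. (F j has_real_derivative F (Suc j) x) (at x)" "\<forall>j. \<forall>x>-1. F j x = V j x"
        "\<forall>x>-1. ((\<lambda>x. (1 - x\<^sup>2) / rho_sin b x * F 1 x) has_real_derivative
          - \<mu> * rho_sin b x * F 0 x - 2 * 0 * x) (at x)" .
    note F = this [rule_format]
    have "(\<lambda>\<phi> \<theta>. complex_of_real (F 0 (sin \<theta>))) \<in> eigsp b \<mu>"
      using zonal_eigenfunction [where E = F, OF b F(1)] F(3) by simp
    from no_zonal [OF this, of "pi/2"] have "F 0 1 = 0" by simp
    then show False using F(2) [of 1 0] V(2) by simp
  qed
  define k where "k = U 0 0 / V 0 0"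
  define D where "D j x = U j x - k * V j x" for j x
  have D: "(D j has_real_derivative D (Suc j) x) (at x)" if "x > -1" for j x
    unfolding D_def [abs_def] by (intro DERIV_diff DERIV_cmult U V that)
  have D0: "D 0 0 = 0" using V0 by (simp add: D_def k_def)
  have D_flux: "((\<lambda>x. (1 - x\<^sup>2) / rho_sin b x * D 1 x) has_real_derivative
        - \<mu> * rho_sin b x * D 0 x - 2 * \<omega> * x) (at x)" if "x > -1" for x
    using DERIV_diff [OF U(2) [OF that] DERIV_cmult [OF V(3) [OF that], of k]]
    by (simp add: D_def algebra_simps diff_divide_distrib add_divide_distrib)
  from odd_extension [where D = D, OF b D D0 D_flux] obtain F :: "nat \<Rightarrow> real \<Rightarrow> real"
    where F_all: "\<forall>j x. (F j has_real_derivative F (Suc j) x) (at x)" "\<forall>j. \<forall>x>-1. F j x = D j x"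
      "\<forall>x>-1. ((\<lambda>x. (1 - x\<^sup>2) / rho_sin b x * F 1 x) has_real_derivative
          - \<mu> * rho_sin b x * F 0 x - 2 * \<omega> * x) (at x)" .
  note F = F_all(1) [rule_format] and F_flux = F_all(3) [rule_format]
  define g where "g t = F 0 (sin t)" for t
  have dg: "(g has_real_derivative F 1 (sin t) * cos t) (at t)" for t
    unfolding g_def [abs_def] using DERIV_chain2 [OF F [of 0] DERIV_sin] by simp
  then have deriv_g: "deriv g = (\<lambda>t. F 1 (sin t) * cos t)"
    by (auto intro!: ext DERIV_imp_deriv)
  have "((\<lambda>t. F 1 (sin t) * cos t) has_real_derivative
      F 2 (sin t) * cos t * cos t - F 1 (sin t) * sin t) (at t)" for t
    using DERIV_mult [OF DERIV_chain2 [OF F [of 1] DERIV_sin] DERIV_cos]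
    by (simp add: numeral_2_eq_2 algebra_simps)
  then have cont: "isCont (\<lambda>t. F 1 (sin t) * cos t) t" for t
    using DERIV_isCont by blast
  \<comment> \<open>\<open>deriv g\<close> is continuous on the whole line and carries the factor
    cos, so both boundary limits are its values at zeros of cos.\<close>
  have lim: "(deriv g \<longlongrightarrow> 0) (at t within S)" if "cos t = 0" for t S
  proof -
    have "((\<lambda>t. F 1 (sin t) * cos t) \<longlongrightarrow> F 1 (sin t) * cos t) (at t)"
      using cont by (simp add: isCont_def)
    then show ?thesis
      unfolding deriv_g using that by (simp add: tendsto_within_subset [of _ _ _ UNIV])
  qed
  have cos_pos: "0 < cos t" if "t \<in> ?I" for t
    using that by (intro cos_gt_zero_pi) auto
  have rnz: "rho_sin b x \<noteq> 0" for x using rho_sin_pos [OF b, of x] by simp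
  have ode: "- lam b l m * g \<theta> = 1 / (cos \<theta> * rho b \<theta>) * deriv (\<lambda>t. cos t / rho b t * deriv g t) \<theta>
      + 2 * \<omega> * sin \<theta> / rho b \<theta>" if \<theta>: "\<theta> \<in> ?I" for \<theta>
  proof -
    have "(sin \<theta>)\<^sup>2 < 1" using cos_pos [OF \<theta>] by (simp add: sin_squared_eq)
    then have s: "- 1 < sin \<theta>" using abs_square_less_1 [of "sin \<theta>"] by (simp add: abs_less_iff)
    have "(\<lambda>t. cos t / rho b t * deriv g t) = (\<lambda>t. (1 - (sin t)\<^sup>2) / rho_sin b (sin t) * F 1 (sin t))"
      unfolding deriv_g rho_eq_rho_sin cos_squared_eq [symmetric] by (simp add: power2_eq_square mult_ac)
    then have "deriv (\<lambda>t. cos t / rho b t * deriv g t) \<theta>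
        = (- \<mu> * rho_sin b (sin \<theta>) * F 0 (sin \<theta>) - 2 * \<omega> * sin \<theta>) * cos \<theta>"
      using DERIV_imp_deriv [OF DERIV_chain2 [OF F_flux [OF s] DERIV_sin]] by simp
    then show ?thesis
      using cos_pos [OF \<theta>] rnz [of "sin \<theta>"] by (simp add: g_def \<mu>_def rho_eq_rho_sin field_simps)
  qed
  have Y: "Y \<in> eigsp b \<mu>" using assms(6) by (simp add: \<mu>_def)
  from span [OF this] obtain c1 c2 where Y_eq: "\<And>\<phi> \<theta>. \<theta> \<in> {-pi/2..pi/2} \<Longrightarrow>
      Y \<phi> \<theta> = c1 * (y1 \<theta> * cis (of_int m * \<phi>)) + c2 * (y2 \<theta> * cis (- of_int m * \<phi>))" by blast
  have diff: "\<exists>A. (\<forall>t\<in>?I. A 0 t = f t) \<and> (\<forall>j. \<forall>t\<in>?I. (A j has_vector_derivative A (Suc j) t) (at t))"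
    if f: "smooth_fun f {-pi/2..pi/2}" for f :: "real \<Rightarrow> complex"
  proof -
    from f obtain A where A: "A 0 = f"
      "\<And>j t. t \<in> {-pi/2..pi/2} \<Longrightarrow> (A j has_vector_derivative A (Suc j) t) (at t within {-pi/2..pi/2})"
      unfolding smooth_fun_def by blast
    have "(A j has_vector_derivative A (Suc j) t) (at t)" if "t \<in> ?I" for j t
      using A(2) [of t j] that by (simp add: at_within_Icc_at)
    with A(1) show ?thesis by blast
  qed
  obtain A where A: "\<And>t. t \<in> ?I \<Longrightarrow> A 0 t = y1 t"
    "\<And>j t. t \<in> ?I \<Longrightarrow> (A j has_vector_derivative A (Suc j) t) (at t)"
    using diff [OF y(1)] by blast
  obtain B where B: "\<And>t. t \<in> ?I \<Longrightarrow> B 0 t = y2 t"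
    "\<And>j t. t \<in> ?I \<Longrightarrow> (B j has_vector_derivative B (Suc j) t) (at t)"
    using diff [OF y(2)] by blast
  \<comment> \<open>The j-th \<theta>-derivative of \<open>Y\<close> on the open interval: the
    expansion in the basis supplies the smoothness that \<open>lap_zonal_add\<close> asks of
    \<open>Y\<close>.\<close>
  define Z where "Z j \<phi> t = c1 * (A j t * cis (of_int m * \<phi>)) + c2 * (B j t * cis (- of_int m * \<phi>))" for j \<phi> t
  have dZ: "(Z j \<phi> has_vector_derivative Z (Suc j) \<phi> t) (at t)" if "t \<in> ?I" for j \<phi> t
    unfolding Z_def [abs_def]
    by (intro has_vector_derivative_add has_vector_derivative_mult_right has_vector_derivative_mult_left
        A(2) B(2) that)
  have dY: "(Y \<phi> has_vector_derivative Z 1 \<phi> t) (at t)" if "t \<in> ?I" for \<phi> t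
    by (rule has_vector_derivative_transform_within_open [OF dZ [OF that, of 0, folded One_nat_def], of ?I])
       (use that in \<open>auto simp: Z_def Y_eq A(1) B(1)\<close>)
  define \<psi> where "\<psi> = (\<lambda>\<phi> \<theta>. complex_of_real (g \<theta>) + Y \<phi> \<theta>)"
  define W where "W = (\<lambda>\<phi> \<theta>. lap b \<psi> \<phi> \<theta> + complex_of_real (2 * \<omega> * sin \<theta> / rho b \<theta>))"
  \<comment> \<open>The forcing in \<open>lap b \<psi>\<close> cancels against the added term of
    \<open>W\<close>, leaving -\<mu> g - \<mu> Y.\<close>
  have W: "W \<phi> t = - of_real \<mu> * \<psi> \<phi> t" if "t \<in> ?I" for \<phi> t
  proof -
    have "lap b \<psi> \<phi> t = of_real (- \<mu> * F 0 (sin t) - 2 * \<omega> * sin t / rho b t) + lap b Y \<phi> t"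
      unfolding \<psi>_def g_def
      by (rule lap_zonal_add [where E = F and Z = "Z 1" and Z' = "Z 2", OF b F F_flux dY _ that])
         (use dZ [of _ 1] in \<open>auto simp: numeral_2_eq_2\<close>)
    moreover have "- lap b Y \<phi> t = of_real \<mu> * Y \<phi> t"
      using Y that by (simp add: eigsp_def)
    ultimately show ?thesis
      by (simp add: W_def \<psi>_def g_def algebra_simps minus_equation_iff [of "lap b Y \<phi> t"])
  qed
  have euler: "- d_theta \<psi> \<phi> \<theta> * d_phi W \<phi> \<theta> + d_phi \<psi> \<phi> \<theta> * d_theta W \<phi> \<theta> = 0"
    if \<theta>: "\<theta> \<in> ?I" for \<phi> \<theta>
  proof -
    have "((\<lambda>p. cis (x * p)) has_vector_derivative (of_real x * (\<i> * cis (x * \<phi>)))) (at \<phi>)" for x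
    proof -
      have "((\<lambda>z. exp (\<i> * (of_real x * z))) has_field_derivative
          of_real x * (\<i> * exp (\<i> * (of_real x * of_real \<phi>)))) (at (of_real \<phi>))"
        by (auto intro!: derivative_eq_intros)
      from has_vector_derivative_real_field [OF this] show ?thesis by (simp add: cis_conv_exp)
    qed
    note dcis = this
    \<comment> \<open>Only existence of the partial derivatives of \<open>\<psi>\<close> matters:
      those of \<open>W\<close> are -\<mu> times them, so the two products cancel.\<close>
    have "\<exists>D. ((\<lambda>p. \<psi> p \<theta>) has_vector_derivative D) (at \<phi>)"
    proof -
      have eq: "(\<lambda>p. \<psi> p \<theta>) = (\<lambda>p. of_real (g \<theta>) +
          (c1 * (y1 \<theta> * cis (of_int m * p)) + c2 * (y2 \<theta> * cis (- of_int m * p))))"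
        using \<theta> by (auto simp: \<psi>_def Y_eq)
      show ?thesis unfolding eq
        by (rule exI, rule has_vector_derivative_add [OF has_vector_derivative_const
            has_vector_derivative_add [OF has_vector_derivative_mult_right [OF has_vector_derivative_mult_right [OF dcis]]
              has_vector_derivative_mult_right [OF has_vector_derivative_mult_right [OF dcis]]]])
    qed
    then obtain P where P: "((\<lambda>p. \<psi> p \<theta>) has_vector_derivative P) (at \<phi>)" ..
    have "((\<lambda>t. complex_of_real (g t)) has_vector_derivative of_real (F 1 (sin \<theta>) * cos \<theta>)) (at \<theta>)"
      using dg by (intro has_vector_derivative_of_real)
        (simp add: has_real_derivative_iff_has_vector_derivative)
    then obtain T where T: "(\<psi> \<phi> has_vector_derivative T) (at \<theta>)"
      unfolding \<psi>_def using has_vector_derivative_add [OF _ dY [OF \<theta>]] by blast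
    have "((\<lambda>p. W p \<theta>) has_vector_derivative - of_real \<mu> * P) (at \<phi>)"
      unfolding W [OF \<theta>] by (rule has_vector_derivative_mult_right [OF P])
    moreover have "(W \<phi> has_vector_derivative - of_real \<mu> * T) (at \<theta>)"
      by (rule has_vector_derivative_transform_within_open
          [OF has_vector_derivative_mult_right [OF T, of "- of_real \<mu>"], of ?I])
         (use \<theta> W in auto)
    ultimately show ?thesis
      using P T by (simp add: d_theta_def d_phi_def vector_derivative_at)
  qed
  show ?thesis
  proof (rule bexI [of _ "1/2"], rule exI [of _ g], intro conjI ballI)
    show "C3_alpha (1/2) ?I g"
      unfolding g_def [abs_def] by (rule C3_alpha_comp_sin [where E = F, OF F])
    show "- lam b l m * g \<theta> = 1 / (cos \<theta> * rho b \<theta>) * deriv (\<lambda>t. cos t / rho b t * deriv g t) \<theta>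
      + 2 * \<omega> * sin \<theta> / rho b \<theta>" if "\<theta> \<in> ?I" for \<theta>
      by (rule ode [OF that])
    show "(deriv g \<longlongrightarrow> 0) (at_left (pi/2))" "(deriv g \<longlongrightarrow> 0) (at_right (-pi/2))"
      by (auto intro: lim)
    show "let \<psi> = (\<lambda>\<phi> \<theta>. complex_of_real (g \<theta>) + Y \<phi> \<theta>);
         W = (\<lambda>\<phi> \<theta>. lap b \<psi> \<phi> \<theta> + complex_of_real (2 * \<omega> * sin \<theta> / rho b \<theta>)) in
      \<forall>\<phi> \<theta>. \<theta> \<in> {-pi/2<..<pi/2} \<longrightarrow>
        - d_theta \<psi> \<phi> \<theta> * d_phi W \<phi> \<theta> + d_phi \<psi> \<phi> \<theta> * d_theta W \<phi> \<theta> = 0"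
      unfolding Let_def \<psi>_def [symmetric] W_def [symmetric] using euler by blast
  qed simp
qed

end
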